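(* Let $(X,d)$ be a complete metric space and let $\mathcal S=(X,(\phi_j)_{j=1}^L,(\rho_j)_{j=1}^L)$ be an IFZS on $X$ consisting of Banach contractions, with fuzzy attractor $u_{\mathcal S}$. Let $\varepsilon>0$, let $\hat X$ be a proper $\varepsilon$-net of $X$, let $r:X\to\hat X$ be an $\varepsilon$-projection, and let $\hat{\mathcal S}=(\hat X,(\hat\phi_j)_{j=1}^L,(\rho_j)_{j=1}^L)$, where $\hat\phi_j:=(r\circ\phi_j)_{|\hat X}$. Then for any $u\in\mathcal F^*_{\hat X}$ and every $n\in\mathbb N$, $$d_\infty\big(e(Z_{\hat{\mathcal S}}^{\,n}(u)),u_{\mathcal S}\big)\le\frac{5\varepsilon}{1-\alpha_{\mathcal S}}+\alpha_{\mathcal S}^{\,n}\,d_\infty(e(u),u_{\mathcal S}).$$ In particular, there is $n_0\in\mathbb N$ such that for every $n\ge n_0$, $e(Z_{\hat{\mathcal S}}^{\,n}(u))$ is an attractor of $\mathcal S$ with resolution $\frac{6\varepsilon}{1-\alpha_{\mathcal S}}$.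
   Context: Fuzzy sets: a fuzzy subset of a set $X$ is a function $u:X\to[0,1]$; $\mathcal F_X$ is the family of all of them. For a metric space $X$, the $\alpha$-cut is $[u]^\alpha=\{x:u(x)\ge\alpha\}$ for $\alpha\in(0,1]$ and $[u]^0=\operatorname{cl}\{x:u(x)>0\}$. $\mathcal F_X^*$ is the set of $u\in\mathcal F_X$ that are normal ($u(x)=1$ for some $x$), upper semicontinuous ($[u]^\alpha$ closed for all $\alpha>0$) and compactly supported ($[u]^0$ compact). With $h$ the Hausdorff metric on nonempty compact sets, $d_\infty(u,v):=\sup_{\alpha\in[0,1]}h([u]^\alpha,[v]^\alpha)$ is a metric on $\mathcal F_X^*$. For $\phi:X\to Y$ and $u\in\mathcal F_X$, the fuzzy set $\phi(u)\in\mathcal F_Y$ is $\phi(u)(y)=\sup\{u(x):x\in\phi^{-1}(y)\}$, with $\sup\emptyset=0$. IFZS: an iterated fuzzy function system $\mathcal S=(X,(\phi_j)_{j=1}^L,(\rho_j)_{j=1}^L)$ consists of finitely many continuous maps $\phi_j:X\to X$ and an admissible system of grey level maps $\rho_j:[0,1]\to[0,1]$, i.e. each $\rho_j$ is nondecreasing, right continuous and satisfies $\rho_j(0)=0$, and $\rho_j(1)=1$ for some $j$. Its operator $Z_{\mathcal S}:\mathcal F_X^*\to\mathcal F_X^*$ is $Z_{\mathcal S}(u)=\max_{1\le j\le L}\rho_j(\phi_j(u))$ (pointwise maximum, $\rho_j(\phi_j(u))=\rho_j\circ\phi_j(u)$). "Consisting of Banach contractions" means $\operatorname{Lip}(\phi_j)<1$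 for all $j$, and then $\alpha_{\mathcal S}:=\max_j\operatorname{Lip}(\phi_j)$. The fuzzy attractor (fuzzy fractal) $u_{\mathcal S}\in\mathcal F_X^*$ is the fuzzy set with $Z_{\mathcal S}(u_{\mathcal S})=u_{\mathcal S}$ and $Z_{\mathcal S}^k(u)\to u_{\mathcal S}$ in $d_\infty$ for every $u\in\mathcal F_X^*$; it exists when $X$ is (nonempty and) complete and the $\phi_j$ are Banach contractions. For $\delta>0$, $u_\delta\in\mathcal F_X^*$ is an attractor of $\mathcal S$ with resolution $\delta$ if $d_\infty(u_\delta,u_{\mathcal S})\le\delta$. Nets: $\hat X\subset X$ is an $\varepsilon$-net of $X$ if for every $x\in X$ there is $y\in\hat X$ with $d(x,y)\le\varepsilon$; it is proper if $D\cap\hat X$ is finite for every bounded $D\subset X$. An $\varepsilon$-projection is a map $r:X\to\hat X$ with $r(x)=x$ for $x\in\hat X$ and $d(x,r(x))\le\varepsilon$ for all $x\in X$. For $u:\hat X\to[0,1]$, $e(u):X\to[0,1]$ is the extension of $u$ by $0$ on $X\setminus\hat X$. *)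

theory Defs
  imports "HOL-Analysis.Analysis"
begin

section \<open>Fuzzy sets on a metric space\<close>

text \<open>
  All notions are relative to a carrier set \<open>A\<close> inside a metric-space type, so that they apply
  both to the whole space and to a net in it. A fuzzy subset of \<open>A\<close> is a function
  \<open>A \<rightarrow> [0,1]\<close>, made \<open>undefined\<close> outside \<open>A\<close> so that equality of fuzzy sets is equality of terms.
\<close>

definition fuzzy_sets :: "'a set \<Rightarrow> ('a \<Rightarrow> real) set" where
  "fuzzy_sets A = A \<rightarrow>\<^sub>E {0..1}"

definition alpha_cut :: "'a::metric_space set \<Rightarrow> ('a \<Rightarrow> real) \<Rightarrow> real \<Rightarrow> 'a set" where
  "alpha_cut A u \<alpha> =
     (if \<alpha> = 0 then (top_of_set A) closure_of {x \<in> A. u x > 0} else {x \<in> A. u x \<ge> \<alpha>})"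

text \<open>Normal, upper semicontinuous and compactly supported fuzzy sets.\<close>

definition fuzzy_star :: "'a::metric_space set \<Rightarrow> ('a \<Rightarrow> real) set" where
  "fuzzy_star A =
     {u \<in> fuzzy_sets A.
        (\<exists>x\<in>A. u x = 1) \<and>
        (\<forall>\<alpha>\<in>{0<..1}. closedin (top_of_set A) (alpha_cut A u \<alpha>)) \<and>
        compact (alpha_cut A u 0)}"

text \<open>
  The Hausdorff metric is only used for nonempty compact sets, where all suprema below are
  finite; likewise \<open>d_infty\<close> is only used on \<open>fuzzy_star\<close>.
\<close>

definition hausdorff_dist :: "'a::metric_space set \<Rightarrow> 'a set \<Rightarrow> real" where
  "hausdorff_dist K L = max (SUP x\<in>K. infdist x L) (SUP y\<in>L. infdist y K)"

definition d_infty :: "'a::metric_space set \<Rightarrow> ('a \<Rightarrow> real) \<Rightarrow> ('a \<Rightarrow> real) \<Rightarrow> real" where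
  "d_infty A u v = (SUP \<alpha>\<in>{0..1}. hausdorff_dist (alpha_cut A u \<alpha>) (alpha_cut A v \<alpha>))"

text \<open>The convention \<open>sup \<emptyset> = 0\<close> is explicit, as \<open>Sup {}\<close> is unspecified on the reals.\<close>

definition fuzzy_image :: "'a set \<Rightarrow> 'b set \<Rightarrow> ('a \<Rightarrow> 'b) \<Rightarrow> ('a \<Rightarrow> real) \<Rightarrow> 'b \<Rightarrow> real" where
  "fuzzy_image A B \<phi> u =
     (\<lambda>y\<in>B. if {x \<in> A. \<phi> x = y} = {} then 0 else (SUP x\<in>{x \<in> A. \<phi> x = y}. u x))"


section \<open>Iterated fuzzy function systems\<close>

definition grey_level_map :: "(real \<Rightarrow> real) \<Rightarrow> bool" where
  "grey_level_map \<rho> \<longleftrightarrow>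
     \<rho> \<in> {0..1} \<rightarrow> {0..1} \<and>
     mono_on {0..1} \<rho> \<and>
     (\<forall>t\<in>{0..1}. continuous (at t within {t..1}) \<rho>) \<and>
     \<rho> 0 = 0"

definition admissible_grey_maps :: "nat \<Rightarrow> (nat \<Rightarrow> real \<Rightarrow> real) \<Rightarrow> bool" where
  "admissible_grey_maps L \<rho> \<longleftrightarrow>
     (\<forall>j\<in>{1..L}. grey_level_map (\<rho> j)) \<and> (\<exists>j\<in>{1..L}. \<rho> j 1 = 1)"

definition ifzs ::
    "'a::metric_space set \<Rightarrow> nat \<Rightarrow> (nat \<Rightarrow> 'a \<Rightarrow> 'a) \<Rightarrow> (nat \<Rightarrow> real \<Rightarrow> real) \<Rightarrow> bool" where
  "ifzs A L \<phi> \<rho> \<longleftrightarrow>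
     (\<forall>j\<in>{1..L}. \<phi> j \<in> A \<rightarrow> A \<and> continuous_on A (\<phi> j)) \<and> admissible_grey_maps L \<rho>"

definition ifzs_op ::
    "'a set \<Rightarrow> nat \<Rightarrow> (nat \<Rightarrow> 'a \<Rightarrow> 'a) \<Rightarrow> (nat \<Rightarrow> real \<Rightarrow> real) \<Rightarrow>
     ('a \<Rightarrow> real) \<Rightarrow> 'a \<Rightarrow> real" where
  "ifzs_op A L \<phi> \<rho> u = (\<lambda>x\<in>A. MAX j\<in>{1..L}. \<rho> j (fuzzy_image A A (\<phi> j) u x))"

text \<open>
  The least Lipschitz constant. It is meaningful only for Lipschitz maps (the infimum of the empty
  set is unspecified), hence the first conjunct of \<open>banach_contraction\<close>.
\<close>

definition Lip :: "'a::metric_space set \<Rightarrow> ('a \<Rightarrow> 'b::metric_space) \<Rightarrow> real" where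
  "Lip A f = Inf {C. C-lipschitz_on A f}"

definition banach_contraction :: "'a::metric_space set \<Rightarrow> ('a \<Rightarrow> 'a) \<Rightarrow> bool" where
  "banach_contraction A f \<longleftrightarrow> (\<exists>C. C-lipschitz_on A f) \<and> Lip A f < 1"

definition contraction_factor :: "'a::metric_space set \<Rightarrow> nat \<Rightarrow> (nat \<Rightarrow> 'a \<Rightarrow> 'a) \<Rightarrow> real" where
  "contraction_factor A L \<phi> = (MAX j\<in>{1..L}. Lip A (\<phi> j))"

definition is_fuzzy_attractor ::
    "'a::metric_space set \<Rightarrow> nat \<Rightarrow> (nat \<Rightarrow> 'a \<Rightarrow> 'a) \<Rightarrow> (nat \<Rightarrow> real \<Rightarrow> real) \<Rightarrow>
     ('a \<Rightarrow> real) \<Rightarrow> bool" where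
  "is_fuzzy_attractor A L \<phi> \<rho> w \<longleftrightarrow>
     w \<in> fuzzy_star A \<and>
     ifzs_op A L \<phi> \<rho> w = w \<and>
     (\<forall>u\<in>fuzzy_star A. (\<lambda>k. d_infty A ((ifzs_op A L \<phi> \<rho> ^^ k) u) w) \<longlonglongrightarrow> 0)"

definition attractor_with_resolution ::
    "'a::metric_space set \<Rightarrow> nat \<Rightarrow> (nat \<Rightarrow> 'a \<Rightarrow> 'a) \<Rightarrow> (nat \<Rightarrow> real \<Rightarrow> real) \<Rightarrow>
     real \<Rightarrow> ('a \<Rightarrow> real) \<Rightarrow> bool" where
  "attractor_with_resolution A L \<phi> \<rho> \<delta> v \<longleftrightarrow>
     \<delta> > 0 \<and> v \<in> fuzzy_star A \<and> (\<exists>w. is_fuzzy_attractor A L \<phi> \<rho> w \<and> d_infty A v w \<le> \<delta>)"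


section \<open>Nets and discretization\<close>

definition eps_net :: "'a::metric_space set \<Rightarrow> real \<Rightarrow> 'a set \<Rightarrow> bool" where
  "eps_net X \<epsilon> N \<longleftrightarrow> N \<subseteq> X \<and> (\<forall>x\<in>X. \<exists>y\<in>N. dist x y \<le> \<epsilon>)"

definition proper_eps_net :: "'a::metric_space set \<Rightarrow> real \<Rightarrow> 'a set \<Rightarrow> bool" where
  "proper_eps_net X \<epsilon> N \<longleftrightarrow>
     eps_net X \<epsilon> N \<and> (\<forall>D. D \<subseteq> X \<and> bounded D \<longrightarrow> finite (D \<inter> N))"

definition eps_projection :: "'a::metric_space set \<Rightarrow> real \<Rightarrow> 'a set \<Rightarrow> ('a \<Rightarrow> 'a) \<Rightarrow> bool" where
  "eps_projection X \<epsilon> N r \<longleftrightarrow>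
     r \<in> X \<rightarrow> N \<and> (\<forall>x\<in>N. r x = x) \<and> (\<forall>x\<in>X. dist x (r x) \<le> \<epsilon>)"

definition zero_ext :: "'a set \<Rightarrow> 'a set \<Rightarrow> ('a \<Rightarrow> real) \<Rightarrow> 'a \<Rightarrow> real" where
  "zero_ext X N u = (\<lambda>x\<in>X. if x \<in> N then u x else 0)"

definition discretized_maps ::
    "'a set \<Rightarrow> ('a \<Rightarrow> 'a) \<Rightarrow> (nat \<Rightarrow> 'a \<Rightarrow> 'a) \<Rightarrow> nat \<Rightarrow> 'a \<Rightarrow> 'a" where
  "discretized_maps N r \<phi> = (\<lambda>j. restrict (r \<circ> \<phi> j) N)"

end

theory Submission
  imports Defs
begin

text \<open>
  For \<open>u, v\<close> in \<open>fuzzy_star X\<close> one has \<open>d_infty X u v \<le> c\<close> iff each point of positive membership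
  in one of them has, within distance \<open>c\<close>, a point of at least the same membership in the other.
  This relation makes sense between fuzzy sets on different carriers, so \<open>u\<close> on the net can be
  compared directly with \<open>uS\<close>. All suprema in the definition of the fuzzy operators are attained
  (by compactness on \<open>X\<close>, by finiteness of supports on the net), so one application of the
  operators turns the bound \<open>c\<close> into \<open>\<alpha>S * c + \<epsilon>\<close>, and iterating yields a geometric series.
\<close>

definition fuzzy_reach ::
    "'a::metric_space set \<Rightarrow> 'a set \<Rightarrow> real \<Rightarrow> ('a \<Rightarrow> real) \<Rightarrow> ('a \<Rightarrow> real) \<Rightarrow> bool" where
  "fuzzy_reach A B c u v \<longleftrightarrow> (\<forall>x\<in>A. 0 < u x \<longrightarrow> (\<exists>y\<in>B. dist x y \<le> c \<and> u x \<le> v y))"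

definition sup_attained :: "'a set \<Rightarrow> ('a \<Rightarrow> 'a) \<Rightarrow> ('a \<Rightarrow> real) \<Rightarrow> bool" where
  "sup_attained A f u \<longleftrightarrow>
     (\<forall>y\<in>A. 0 < fuzzy_image A A f u y \<longrightarrow> (\<exists>x\<in>A. f x = y \<and> u x = fuzzy_image A A f u y))"

section \<open>Images of fuzzy sets and the operator of an iterated fuzzy function system\<close>

lemma fuzzy_setsD:
  assumes "u \<in> fuzzy_sets A" "x \<in> A"
  shows "0 \<le> u x" "u x \<le> 1"
  using assms by (auto simp: fuzzy_sets_def dest: PiE_mem)

lemma fuzzy_image_bounds:
  assumes "u \<in> fuzzy_sets A" "y \<in> B"
  shows "0 \<le> fuzzy_image A B f u y" "fuzzy_image A B f u y \<le> 1"
proof -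
  have bdd: "bdd_above (u ` {x \<in> A. f x = y})"
    by (rule bdd_aboveI2[where M = 1]) (use fuzzy_setsD[OF assms(1)] in auto)
  show "fuzzy_image A B f u y \<le> 1"
    using fuzzy_setsD[OF assms(1)] assms(2) by (auto simp: fuzzy_image_def intro!: cSUP_least)
  show "0 \<le> fuzzy_image A B f u y"
    using fuzzy_setsD[OF assms(1)] assms(2) cSUP_upper2[OF bdd, of _ 0]
    by (auto simp: fuzzy_image_def)
qed

lemma fuzzy_image_upper:
  assumes "u \<in> fuzzy_sets A" "x \<in> A" "f x \<in> B"
  shows "u x \<le> fuzzy_image A B f u (f x)"
proof -
  have "bdd_above (u ` {x' \<in> A. f x' = f x})"
    by (rule bdd_aboveI2[where M = 1]) (use fuzzy_setsD[OF assms(1)] in auto)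
  then show ?thesis
    using assms by (auto simp: fuzzy_image_def intro!: cSUP_upper)
qed

lemma fuzzy_image_approx:
  assumes "0 < fuzzy_image A B f u y" "y \<in> B" "s < fuzzy_image A B f u y"
  obtains x where "x \<in> A" "f x = y" "s < u x"
proof -
  \<comment> \<open>A positive value excludes the default 0 for an empty fibre, so the value is a
    genuine supremum.\<close>
  have ne: "{x \<in> A. f x = y} \<noteq> {}"
    and eq: "fuzzy_image A B f u y = (SUP x\<in>{x \<in> A. f x = y}. u x)"
    using assms(1,2) by (auto simp: fuzzy_image_def split: if_splits)
  have "\<exists>x\<in>{x \<in> A. f x = y}. s < u x"
  proof (rule ccontr)
    assume "\<not> ?thesis"
    then have "(SUP x\<in>{x \<in> A. f x = y}. u x) \<le> s"
      using ne by (intro cSUP_least) auto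
    with assms(3) eq show False by simp
  qed
  then show ?thesis using that by auto
qed

lemma grey_level_mapD:
  assumes "grey_level_map \<rho>"
  shows "t \<in> {0..1} \<Longrightarrow> \<rho> t \<in> {0..1}" "0 \<le> s \<Longrightarrow> s \<le> t \<Longrightarrow> t \<le> 1 \<Longrightarrow> \<rho> s \<le> \<rho> t"
  using assms by (auto simp: grey_level_map_def Pi_iff mono_on_def)

text \<open>The free level \<open>s\<close> lets the membership of a point in another carrier be
  carried along: monotonicity of the grey level map turns \<open>s \<le> u x\<close> into a bound at
  \<open>f j x\<close>.\<close>

lemma ifzs_op_upper:
  assumes "admissible_grey_maps L \<rho>" "u \<in> fuzzy_sets A" "j \<in> {1..L}" "x \<in> A" "f j x \<in> A" "0 \<le> s" "s \<le> u x"
  shows "\<rho> j s \<le> ifzs_op A L f \<rho> u (f j x)"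
proof -
  have "grey_level_map (\<rho> j)" using assms(1,3) by (simp add: admissible_grey_maps_def)
  moreover have "s \<le> fuzzy_image A A (f j) u (f j x)"
    using fuzzy_image_upper[of u A x "f j" A] assms by simp
  ultimately have "\<rho> j s \<le> \<rho> j (fuzzy_image A A (f j) u (f j x))"
    using assms(6) fuzzy_image_bounds(2)[where f = "f j", OF assms(2,5)]
    by (metis grey_level_mapD(2))
  also have "\<dots> \<le> ifzs_op A L f \<rho> u (f j x)"
    using assms(3,5) Max_ge[of "(\<lambda>i. \<rho> i (fuzzy_image A A (f i) u (f j x))) ` {1..L}"]
    by (simp add: ifzs_op_def)
  finally show ?thesis .
qed

lemma ifzs_op_in_fuzzy_sets:
  assumes "admissible_grey_maps L \<rho>" "u \<in> fuzzy_sets A"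
  shows "ifzs_op A L f \<rho> u \<in> fuzzy_sets A"
proof -
  have range: "(MAX j\<in>{1..L}. \<rho> j (fuzzy_image A A (f j) u y)) \<in> {0..1}" if y: "y \<in> A" for y
  proof -
    have "{1..L} \<noteq> {}" using assms(1) by (auto simp: admissible_grey_maps_def)
    then have "(MAX j\<in>{1..L}. \<rho> j (fuzzy_image A A (f j) u y))
        \<in> (\<lambda>j. \<rho> j (fuzzy_image A A (f j) u y)) ` {1..L}"
      by (intro Max_in) auto
    then obtain j where j: "j \<in> {1..L}"
      "(MAX j\<in>{1..L}. \<rho> j (fuzzy_image A A (f j) u y)) = \<rho> j (fuzzy_image A A (f j) u y)"
      by (rule imageE)
    show ?thesis
      unfolding j(2)
      using assms(1) j(1) fuzzy_image_bounds[where f = "f j", OF assms(2) y]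
        grey_level_mapD(1)[of "\<rho> j" "fuzzy_image A A (f j) u y"]
      by (simp add: admissible_grey_maps_def)
  qed
  show ?thesis
    unfolding ifzs_op_def fuzzy_sets_def restrict_PiE_iff by (rule ballI) (rule range)
qed

lemma ifzs_op_posE:
  assumes "admissible_grey_maps L \<rho>" "u \<in> fuzzy_sets A" "y \<in> A" "0 < ifzs_op A L f \<rho> u y"
    and "\<And>j. j \<in> {1..L} \<Longrightarrow> sup_attained A (f j) u"
  obtains j x where "j \<in> {1..L}" "x \<in> A" "f j x = y" "0 < u x" "ifzs_op A L f \<rho> u y = \<rho> j (u x)"
proof -
  have "{1..L} \<noteq> {}" using assms(1) by (auto simp: admissible_grey_maps_def)
  then have "(MAX j\<in>{1..L}. \<rho> j (fuzzy_image A A (f j) u y))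
        \<in> (\<lambda>j. \<rho> j (fuzzy_image A A (f j) u y)) ` {1..L}"
    by (intro Max_in) auto
  then obtain j where j: "j \<in> {1..L}"
    "ifzs_op A L f \<rho> u y = \<rho> j (fuzzy_image A A (f j) u y)"
    using assms(3) by (auto simp: ifzs_op_def)
  \<comment> \<open>Grey level maps fix 0, so a positive value of the operator needs a positive
    image value. This is the case covered by \<open>sup_attained\<close>, and it makes the
    membership of the preimage positive.\<close>
  have "\<rho> j 0 = 0" using assms(1) j(1) by (auto simp: admissible_grey_maps_def grey_level_map_def)
  then have "fuzzy_image A A (f j) u y \<noteq> 0" using j(2) assms(4) by auto
  then have "0 < fuzzy_image A A (f j) u y"
    using fuzzy_image_bounds(1)[OF assms(2,3), of "f j"] by simp
  then show ?thesis
    using assms(3) assms(5)[OF j(1)] j that unfolding sup_attained_def by metis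
qed

text \<open>A point \<open>y\<close> of positive membership comes from some \<open>x\<close> through
  a map \<open>f j\<close>. If \<open>x'\<close> in \<open>B\<close> is reached from
  \<open>x\<close>, then \<open>g j x'\<close> is reached from \<open>y\<close>, with the same index
  \<open>j\<close>, hence the same grey level map. Separate carriers and separate families of maps
  allow a comparison of the net with the whole space in both directions.\<close>

lemma fuzzy_reach_ifzs_op:
  assumes "admissible_grey_maps L \<rho>" "u \<in> fuzzy_sets A" "v \<in> fuzzy_sets B"
    and "\<And>j. j \<in> {1..L} \<Longrightarrow> sup_attained A (f j) u"
    and "\<And>j. j \<in> {1..L} \<Longrightarrow> g j \<in> B \<rightarrow> B"
    and "\<And>j x y. j \<in> {1..L} \<Longrightarrow> x \<in> A \<Longrightarrow> y \<in> B \<Longrightarrow> dist x y \<le> c \<Longrightarrow> dist (f j x) (g j y) \<le> c'"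
    and "fuzzy_reach A B c u v"
  shows "fuzzy_reach A B c' (ifzs_op A L f \<rho> u) (ifzs_op B L g \<rho> v)"
  unfolding fuzzy_reach_def
proof (intro ballI impI)
  fix y assume y: "y \<in> A" "0 < ifzs_op A L f \<rho> u y"
  obtain j x where j: "j \<in> {1..L}" "x \<in> A" "f j x = y" "0 < u x" "ifzs_op A L f \<rho> u y = \<rho> j (u x)"
    using ifzs_op_posE[of L \<rho> u A y f] assms(1,2,4) y by metis
  obtain x' where x': "x' \<in> B" "dist x x' \<le> c" "u x \<le> v x'"
    using assms(7) j by (auto simp: fuzzy_reach_def)
  have "g j x' \<in> B" using assms(5) j(1) x'(1) by auto
  moreover have "dist y (g j x') \<le> c'" using assms(6) j x' by blast
  moreover have "ifzs_op A L f \<rho> u y \<le> ifzs_op B L g \<rho> v (g j x')"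
    using ifzs_op_upper[where f = g and s = "u x", OF assms(1,3) j(1) x'(1) calculation(1)] j x'
    by simp
  ultimately show "\<exists>y'\<in>B. dist y y' \<le> c' \<and> ifzs_op A L f \<rho> u y \<le> ifzs_op B L g \<rho> v y'" by blast
qed

section \<open>Cuts, and the metric expressed through reachability\<close>

lemma support_subset_alpha_cut_0: "{x \<in> A. 0 < u x} \<subseteq> alpha_cut A u 0"
  by (auto simp: alpha_cut_def intro!: closure_of_subset[THEN subsetD])

lemma alpha_cut_0_closure:
  "alpha_cut A u 0 = A \<inter> closure {x \<in> A. 0 < u x}"
  by (auto simp: alpha_cut_def closure_of_subtopology Int_absorb1 Collect_conj_eq)

lemma fuzzy_star_alpha_cut:
  assumes "u \<in> fuzzy_star A" "\<alpha> \<in> {0..1}"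
  shows "compact (alpha_cut A u \<alpha>)" "alpha_cut A u \<alpha> \<noteq> {}" "alpha_cut A u \<alpha> \<subseteq> alpha_cut A u 0"
proof -
  obtain x where x: "x \<in> A" "u x = 1" using assms(1) by (auto simp: fuzzy_star_def)
  have "x \<in> alpha_cut A u \<alpha>"
    using x assms(2) support_subset_alpha_cut_0[of A u] by (cases "\<alpha> = 0") (auto simp: alpha_cut_def)
  then show "alpha_cut A u \<alpha> \<noteq> {}" by auto
  show sub: "alpha_cut A u \<alpha> \<subseteq> alpha_cut A u 0"
    using support_subset_alpha_cut_0[of A u] assms(2) by (cases "\<alpha> = 0") (auto simp: alpha_cut_def)
  have cpt: "compact (alpha_cut A u 0)" using assms(1) by (auto simp: fuzzy_star_def)
  show "compact (alpha_cut A u \<alpha>)"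
  proof (cases "\<alpha> = 0")
    case False
    then have "closedin (top_of_set A) (alpha_cut A u \<alpha>)"
      using assms by (auto simp: fuzzy_star_def)
    then obtain C where C: "closed C" "alpha_cut A u \<alpha> = A \<inter> C"
      by (auto simp: closedin_closed)
    \<comment> \<open>The cut is only relatively closed in \<open>A\<close>; its compactness comes
      from lying in the compact cut at level 0.\<close>
    then have "alpha_cut A u \<alpha> = alpha_cut A u 0 \<inter> C"
      using sub by (auto simp: alpha_cut_0_closure)
    then show ?thesis using cpt C(1) by (simp add: compact_Int_closed)
  qed (use cpt in simp)
qed

text \<open>At a positive level, the reached point lies in the cut of the same level. At level 0 a
  point of the cut may have membership 0, so the bound is first shown on the support and then passed
  to the closure.\<close>

lemma d_infty_le:
  assumes "u \<in> fuzzy_star A" "v \<in> fuzzy_star A"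
    and "fuzzy_reach A A c u v" "fuzzy_reach A A c v u"
  shows "d_infty A u v \<le> c"
proof -
  have main: "infdist x (alpha_cut A v \<alpha>) \<le> c"
    if uv: "fuzzy_reach A A c u v" and \<alpha>: "\<alpha> \<in> {0..1}" and x: "x \<in> alpha_cut A u \<alpha>" for u v x \<alpha>
  proof (cases "\<alpha> = 0")
    case False
    then have "x \<in> A" "\<alpha> \<le> u x" "0 < u x" using x \<alpha> by (auto simp: alpha_cut_def)
    then obtain y where "y \<in> A" "dist x y \<le> c" "u x \<le> v y" using uv by (auto simp: fuzzy_reach_def)
    then have "y \<in> alpha_cut A v \<alpha>" using False \<open>\<alpha> \<le> u x\<close> by (auto simp: alpha_cut_def)
    then show ?thesis using \<open>dist x y \<le> c\<close> by (rule infdist_le2)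
  next
    case True
    have "infdist z (alpha_cut A v 0) \<le> c" if z: "z \<in> {x \<in> A. 0 < u x}" for z
    proof -
      obtain y where "y \<in> A" "dist z y \<le> c" "u z \<le> v y"
        using uv z unfolding fuzzy_reach_def by blast
      then have "y \<in> alpha_cut A v 0" using z support_subset_alpha_cut_0[of A v] by force
      then show ?thesis using \<open>dist z y \<le> c\<close> by (rule infdist_le2)
    qed
    then have "{x \<in> A. 0 < u x} \<subseteq> {z. infdist z (alpha_cut A v 0) \<le> c}" by blast
    \<comment> \<open>\<open>infdist\<close> is continuous, so this sublevel set is closed and
      contains the closure of the support along with the support.\<close>
    moreover have "closed {z. infdist z (alpha_cut A v 0) \<le> c}"
      by (intro closed_Collect_le continuous_intros)
    ultimately have "closure {x \<in> A. 0 < u x} \<subseteq> {z. infdist z (alpha_cut A v 0) \<le> c}"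
      by (rule closure_minimal)
    then show ?thesis using x True by (auto simp: alpha_cut_0_closure)
  qed
  have "hausdorff_dist (alpha_cut A u \<alpha>) (alpha_cut A v \<alpha>) \<le> c" if "\<alpha> \<in> {0..1}" for \<alpha>
    unfolding hausdorff_dist_def
    using main[OF assms(3) that] main[OF assms(4) that]
      fuzzy_star_alpha_cut(2)[OF assms(1) that] fuzzy_star_alpha_cut(2)[OF assms(2) that]
    by (auto intro!: cSUP_least)
  then show ?thesis unfolding d_infty_def by (intro cSUP_least) auto
qed

lemma hausdorff_dist_commute: "hausdorff_dist K L = hausdorff_dist L K"
  by (simp add: hausdorff_dist_def max.commute)

lemma d_infty_commute: "d_infty A u v = d_infty A v u"
  by (simp add: d_infty_def hausdorff_dist_commute)

lemma bdd_above_infdist: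
  assumes "bounded K"
  shows "bdd_above ((\<lambda>x. infdist x L) ` K)"
proof -
  have "bounded ((\<lambda>x. infdist x L) ` K)"
  proof -
    obtain a e where e: "\<forall>x\<in>K. dist a x \<le> e" using assms by (auto simp: bounded_def)
    have "infdist x L \<le> infdist a L + e" if "x \<in> K" for x
      using infdist_triangle[of x L a] e that by (auto simp: dist_commute intro: order_trans)
    then show ?thesis
      by (auto simp: bounded_iff infdist_nonneg intro!: exI[of _ "infdist a L + e"])
  qed
  then show ?thesis by (rule bounded_imp_bdd_above)
qed

text \<open>For a point \<open>x\<close> the relevant level is \<open>u x\<close>: a nearest point
  of the compact cut of \<open>v\<close> at that level has membership at least \<open>u x\<close>
  and lies within the Hausdorff distance of the two cuts.\<close>

lemma fuzzy_reach_d_infty: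
  assumes u: "u \<in> fuzzy_star A" and v: "v \<in> fuzzy_star A"
  shows "fuzzy_reach A A (d_infty A u v) u v"
  unfolding fuzzy_reach_def
proof (intro ballI impI)
  fix x assume x: "x \<in> A" "0 < u x"
  define H where "H = (\<lambda>\<alpha>. hausdorff_dist (alpha_cut A u \<alpha>) (alpha_cut A v \<alpha>))"
  have "bounded (alpha_cut A u 0 \<union> alpha_cut A v 0)"
    using fuzzy_star_alpha_cut(1)[OF u, of 0] fuzzy_star_alpha_cut(1)[OF v, of 0]
    by (auto simp: compact_imp_bounded)
  then obtain M where M: "\<And>a b. a \<in> alpha_cut A u 0 \<union> alpha_cut A v 0 \<Longrightarrow>
      b \<in> alpha_cut A u 0 \<union> alpha_cut A v 0 \<Longrightarrow> dist a b \<le> M"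
    by (auto simp: bounded_two_points)
  \<comment> \<open>All cuts lie in the union of the two cuts at level 0, whose diameter bounds
    every Hausdorff distance. Without an upper bound the real supremum in \<open>d_infty\<close>
    could not be compared with its members.\<close>
  have "H \<alpha> \<le> M" if \<alpha>: "\<alpha> \<in> {0..1}" for \<alpha>
  proof -
    have inf: "infdist a L \<le> M"
      if "a \<in> alpha_cut A u 0 \<union> alpha_cut A v 0" "L \<noteq> {}" "L \<subseteq> alpha_cut A u 0 \<union> alpha_cut A v 0" for a L
      using that M infdist_le2 by (metis ex_in_conv subsetD)
    show ?thesis
      unfolding H_def hausdorff_dist_def
      using fuzzy_star_alpha_cut(2,3)[OF u \<alpha>] fuzzy_star_alpha_cut(2,3)[OF v \<alpha>]
      by (intro max.boundedI cSUP_least inf) auto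
  qed
  then have "bdd_above (H ` {0..1})" by (rule bdd_aboveI2)
  moreover have ux: "u x \<in> {0..1}" using u x(1) fuzzy_setsD[of u A x] by (auto simp: fuzzy_star_def)
  ultimately have "H (u x) \<le> d_infty A u v" unfolding d_infty_def H_def by (intro cSUP_upper)
  moreover have "infdist x (alpha_cut A v (u x)) \<le> H (u x)"
  proof -
    have "x \<in> alpha_cut A u (u x)" using x by (auto simp: alpha_cut_def)
    then have "infdist x (alpha_cut A v (u x)) \<le> (SUP x'\<in>alpha_cut A u (u x). infdist x' (alpha_cut A v (u x)))"
      using fuzzy_star_alpha_cut(1)[OF u ux]
      by (intro cSUP_upper bdd_above_infdist) (auto simp: compact_imp_bounded)
    then show ?thesis by (simp add: H_def hausdorff_dist_def)
  qed
  ultimately have "infdist x (alpha_cut A v (u x)) \<le> d_infty A u v" by simp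
  moreover obtain y where y: "y \<in> alpha_cut A v (u x)" "\<And>z. z \<in> alpha_cut A v (u x) \<Longrightarrow> dist x y \<le> dist x z"
    using continuous_attains_inf[OF fuzzy_star_alpha_cut(1,2)[OF v ux]
        continuous_on_dist[OF continuous_on_const continuous_on_id]] by blast
  moreover have "dist x y \<le> infdist x (alpha_cut A v (u x))"
    using y by (auto simp: infdist_def intro!: cINF_greatest)
  ultimately show "\<exists>y\<in>A. dist x y \<le> d_infty A u v \<and> u x \<le> v y"
    using x(2) by (intro bexI[of _ y]) (auto simp: alpha_cut_def)
qed

section \<open>Attained suprema and finite supports\<close>

text \<open>The parts of the fibre with membership at least \<open>s\<close>, for \<open>s\<close>
  below the supremum, are compact, nonempty and nested. A common point has membership at least every
  such \<open>s\<close>, hence at least the supremum.\<close>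

lemma sup_attained_fuzzy_star:
  assumes u: "u \<in> fuzzy_star A" and f: "continuous_on A f"
  shows "sup_attained A f u"
  unfolding sup_attained_def
proof (intro ballI impI)
  fix y assume y: "y \<in> A" and pos: "0 < fuzzy_image A A f u y"
  define S where "S = fuzzy_image A A f u y"
  have uA: "u \<in> fuzzy_sets A" using u by (auto simp: fuzzy_star_def)
  define C where "C = (\<lambda>s. {x \<in> A. f x = y \<and> s \<le> u x})"
  have S1: "0 < S" "S \<le> 1" using pos fuzzy_image_bounds[OF uA y] by (auto simp: S_def)
  have cpt: "compact (C s)" if "s \<in> {0<..<S}" for s
  proof -
    have s: "s \<in> {0..1}" "s \<noteq> 0" using that S1 by auto
    have "closedin (top_of_set (alpha_cut A u s)) (alpha_cut A u s \<inter> f -` {y})"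
      by (rule continuous_closedin_preimage)
        (use f s in \<open>auto simp: alpha_cut_def elim: continuous_on_subset\<close>)
    moreover have "alpha_cut A u s \<inter> f -` {y} = C s" using s by (auto simp: C_def alpha_cut_def)
    ultimately show ?thesis
      using fuzzy_star_alpha_cut(1)[OF u s(1)] closedin_compact by metis
  qed
  have ne: "C s \<noteq> {}" if s: "s < S" for s
  proof -
    obtain x where "x \<in> A" "f x = y" "s < u x"
      using fuzzy_image_approx[OF pos y, of s] s unfolding S_def by blast
    then have "x \<in> C s" by (simp add: C_def)
    then show ?thesis by blast
  qed
  have "\<Inter> (C ` {0<..<S}) \<noteq> {}"
  proof -
    \<comment> \<open>\<open>C (S / 2)\<close> is the compact set in which the finite intersection
      property is used. For finitely many levels the largest one, \<open>m\<close>, gives the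
      smallest set, which is nonempty because \<open>m < S\<close>.\<close>
    have "C (S / 2) \<inter> (\<Inter>s\<in>{0<..<S}. C s) \<noteq> {}"
    proof (rule compact_imp_fip_image)
      fix I assume I: "finite I" "I \<subseteq> {0<..<S}"
      define m where "m = Max (insert (S / 2) I)"
      have "m \<in> insert (S / 2) I" unfolding m_def using I(1) by (intro Max_in) auto
      then have "m < S" using I(2) S1 by auto
      moreover have "C m \<subseteq> C s" if "s \<in> insert (S / 2) I" for s
        using Max_ge[OF _ that] I(1) by (auto simp: C_def m_def[symmetric] intro: order_trans)
      ultimately show "C (S / 2) \<inter> (\<Inter>s\<in>I. C s) \<noteq> {}" using ne[of m] by fast
    qed (use cpt S1 in \<open>auto simp: compact_imp_closed\<close>)
    then show ?thesis by blast
  qed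
  then obtain x where x: "\<And>s. s \<in> {0<..<S} \<Longrightarrow> x \<in> C s" by blast
  have "x \<in> A" "f x = y" using x[of "S / 2"] S1 by (auto simp: C_def)
  moreover have "S \<le> u x"
    by (rule dense_le_bounded[OF S1(1)]) (use x in \<open>auto simp: C_def\<close>)
  moreover have "u x \<le> S" using fuzzy_image_upper[OF uA, of x f A] calculation y by (auto simp: S_def)
  ultimately show "\<exists>x\<in>A. f x = y \<and> u x = fuzzy_image A A f u y" by (auto simp: S_def)
qed

text \<open>A finite support is closed and so equals the cut at level 0; the cuts at positive levels
  are subsets of it, hence finite and closed.\<close>

lemma finite_support_fuzzy_star:
  assumes "u \<in> fuzzy_sets A" "finite {x \<in> A. 0 < u x}" "x \<in> A" "u x = 1"
  shows "u \<in> fuzzy_star A"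
proof -
  have "alpha_cut A u 0 = {x \<in> A. 0 < u x}"
    using finite_imp_closed[OF assms(2)] by (auto simp: alpha_cut_0_closure)
  moreover have "finite (alpha_cut A u \<alpha>)" if "\<alpha> \<in> {0<..1}" for \<alpha>
    by (rule finite_subset[OF _ assms(2)]) (use that in \<open>auto simp: alpha_cut_def\<close>)
  moreover have "alpha_cut A u \<alpha> \<subseteq> A" for \<alpha>
    by (cases "\<alpha> = 0") (auto simp: alpha_cut_0_closure, auto simp: alpha_cut_def)
  ultimately show ?thesis
    using assms by (auto simp: fuzzy_star_def finite_imp_compact intro!: closed_subset finite_imp_closed)
qed

text \<open>The second assumption is what properness of a net provides: compact support makes the
  support bounded, and bounded subsets of the net are finite.\<close>

lemma fuzzy_star_finite_support:
  assumes "u \<in> fuzzy_star A" "\<And>D. D \<subseteq> A \<Longrightarrow> bounded D \<Longrightarrow> finite D"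
  shows "finite {x \<in> A. 0 < u x}"
proof -
  have "bounded (alpha_cut A u 0)"
    using fuzzy_star_alpha_cut(1)[OF assms(1), of 0] by (simp add: compact_imp_bounded)
  then have "bounded {x \<in> A. 0 < u x}"
    by (rule bounded_subset[OF _ support_subset_alpha_cut_0])
  then show ?thesis by (intro assms(2)) auto
qed

text \<open>The fibre carries only finitely many positive values, and the largest of them is the
  supremum.\<close>

lemma sup_attained_finite_support:
  assumes "u \<in> fuzzy_sets A" and fin: "finite {x \<in> A. 0 < u x}"
  shows "sup_attained A f u"
  unfolding sup_attained_def
proof (intro ballI impI)
  fix y assume y: "y \<in> A" and pos: "0 < fuzzy_image A A f u y"
  define V where "V = u ` ({x \<in> A. 0 < u x} \<inter> f -` {y})"
  obtain x0 where x0: "x0 \<in> A" "f x0 = y" "0 < u x0"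
    using fuzzy_image_approx[OF pos y pos] by blast
  have V: "finite V" "V \<noteq> {}" using fin x0 by (auto simp: V_def)
  then have "Max V \<in> u ` ({x \<in> A. 0 < u x} \<inter> f -` {y})"
    using Max_in[OF V] unfolding V_def by simp
  then obtain x where x: "x \<in> A" "f x = y" "u x = Max V"
    by auto
  moreover have "fuzzy_image A A f u y \<le> Max V"
  proof (rule ccontr)
    assume "\<not> ?thesis"
    then obtain z where z: "z \<in> A" "f z = y" "Max V < u z"
      using fuzzy_image_approx[OF pos y, of "Max V"] by auto
    \<comment> \<open>A value above \<open>Max V\<close> would exceed \<open>u x0\<close>, hence be
      positive, and so already belong to \<open>V\<close>.\<close>
    have "0 < u z" using z(3) Max_ge[OF V(1), of "u x0"] x0 by (auto simp: V_def)
    then have "u z \<le> Max V" using z V(1) by (intro Max_ge) (auto simp: V_def)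
    with z(3) show False by simp
  qed
  moreover have "u x \<le> fuzzy_image A A f u y"
    using fuzzy_image_upper[OF assms(1) x(1), of f A] x(2) y by simp
  ultimately show "\<exists>x\<in>A. f x = y \<and> u x = fuzzy_image A A f u y" by auto
qed

text \<open>A point of membership 1 is sent by the map with \<open>\<rho> i 1 = 1\<close> to another
  such point, which gives normality. The new support lies in the union of finitely many images of a
  finite support.\<close>

lemma ifzs_op_fuzzy_star_finite_support:
  assumes "admissible_grey_maps L \<rho>" "\<And>j. j \<in> {1..L} \<Longrightarrow> f j \<in> A \<rightarrow> A"
    and "u \<in> fuzzy_star A" "\<And>D. D \<subseteq> A \<Longrightarrow> bounded D \<Longrightarrow> finite D"
  shows "ifzs_op A L f \<rho> u \<in> fuzzy_star A"
proof -
  have u: "u \<in> fuzzy_sets A" using assms(3) by (auto simp: fuzzy_star_def)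
  have fin: "finite {x \<in> A. 0 < u x}" by (rule fuzzy_star_finite_support[OF assms(3,4)])
  have Zu: "ifzs_op A L f \<rho> u \<in> fuzzy_sets A" by (rule ifzs_op_in_fuzzy_sets[OF assms(1) u])
  obtain x where x: "x \<in> A" "u x = 1" using assms(3) by (auto simp: fuzzy_star_def)
  obtain i where i: "i \<in> {1..L}" "\<rho> i 1 = 1" using assms(1) by (auto simp: admissible_grey_maps_def)
  have fx: "f i x \<in> A" using assms(2)[OF i(1)] x(1) by auto
  have "ifzs_op A L f \<rho> u (f i x) = 1"
    using ifzs_op_upper[where s = 1 and f = f, OF assms(1) u i(1) x(1) fx] fuzzy_setsD(2)[OF Zu fx] x i by simp
  moreover have "{y \<in> A. 0 < ifzs_op A L f \<rho> u y} \<subseteq> (\<Union>j\<in>{1..L}. f j ` {x \<in> A. 0 < u x})"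
  proof
    fix y assume "y \<in> {y \<in> A. 0 < ifzs_op A L f \<rho> u y}"
    then obtain j x where "j \<in> {1..L}" "x \<in> A" "f j x = y" "0 < u x"
      using ifzs_op_posE[OF assms(1) u] sup_attained_finite_support[OF u fin] 
      by (metis (no_types, lifting) mem_Collect_eq)
    then show "y \<in> (\<Union>j\<in>{1..L}. f j ` {x \<in> A. 0 < u x})" by blast
  qed
  then have "finite {y \<in> A. 0 < ifzs_op A L f \<rho> u y}"
    by (rule finite_subset) (use fin in auto)
  ultimately show ?thesis using finite_support_fuzzy_star[OF Zu _ fx] by blast
qed

section \<open>Extension by zero from the net\<close>

lemma zero_ext_fuzzy_star:
  assumes "u \<in> fuzzy_star N" "finite {x \<in> N. 0 < u x}" "N \<subseteq> X"
  shows "zero_ext X N u \<in> fuzzy_star X"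
proof -
  obtain x where x: "x \<in> N" "u x = 1" using assms(1) by (auto simp: fuzzy_star_def)
  have u: "u \<in> fuzzy_sets N" using assms(1) by (auto simp: fuzzy_star_def)
  have "{x \<in> X. 0 < zero_ext X N u x} = {x \<in> N. 0 < u x}"
    using assms(3) by (auto simp: zero_ext_def split: if_splits)
  then show ?thesis
    using assms(2,3) x fuzzy_setsD[OF u]
    by (intro finite_support_fuzzy_star[of _ _ x]) (auto simp: zero_ext_def fuzzy_sets_def)
qed

lemma fuzzy_reach_zero_ext_left:
  assumes "N \<subseteq> X"
  shows "fuzzy_reach X B c (zero_ext X N u) v \<longleftrightarrow> fuzzy_reach N B c u v"
proof -
  have "0 < zero_ext X N u x \<longleftrightarrow> x \<in> N \<and> 0 < u x" "x \<in> N \<Longrightarrow> zero_ext X N u x = u x"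
    if "x \<in> X" for x
    using that assms by (auto simp: zero_ext_def)
  then show ?thesis
    unfolding fuzzy_reach_def using assms by (metis subsetD)
qed

text \<open>The sources in \<open>fuzzy_reach\<close> have positive membership, so a reached point
  has positive membership in the extension and therefore lies in \<open>N\<close>.\<close>

lemma fuzzy_reach_zero_ext_right:
  assumes "N \<subseteq> X"
  shows "fuzzy_reach A X c v (zero_ext X N u) \<longleftrightarrow> fuzzy_reach A N c v u"
proof -
  have "(\<exists>y\<in>X. dist x y \<le> c \<and> v x \<le> zero_ext X N u y) \<longleftrightarrow> (\<exists>y\<in>N. dist x y \<le> c \<and> v x \<le> u y)"
    if "0 < v x" for x
  proof
    assume "\<exists>y\<in>X. dist x y \<le> c \<and> v x \<le> zero_ext X N u y"
    then obtain y where y: "y \<in> X" "dist x y \<le> c" "v x \<le> zero_ext X N u y" by blast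
    then have "y \<in> N" using \<open>0 < v x\<close> by (auto simp: zero_ext_def split: if_splits)
    then show "\<exists>y\<in>N. dist x y \<le> c \<and> v x \<le> u y" using y by (auto simp: zero_ext_def)
  next
    assume "\<exists>y\<in>N. dist x y \<le> c \<and> v x \<le> u y"
    then show "\<exists>y\<in>X. dist x y \<le> c \<and> v x \<le> zero_ext X N u y"
      using assms by (auto simp: zero_ext_def)
  qed
  then show ?thesis by (auto simp: fuzzy_reach_def)
qed

section \<open>Lipschitz constants and the error estimate\<close>

text \<open>The infimum of the Lipschitz constants is itself one, because every difference quotient
  is a lower bound for all of them.\<close>

lemma Lip_lipschitz:
  assumes "C-lipschitz_on A f"
  shows "(Lip A f)-lipschitz_on A f"
proof (rule lipschitz_onI)
  have ne: "{C. C-lipschitz_on A f} \<noteq> {}" using assms by auto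
  show "0 \<le> Lip A f"
    unfolding Lip_def using ne by (intro cInf_greatest) (auto simp: lipschitz_on_nonneg)
  fix x y assume xy: "x \<in> A" "y \<in> A"
  show "dist (f x) (f y) \<le> Lip A f * dist x y"
  proof (cases "x = y")
    case False
    have "dist (f x) (f y) / dist x y \<le> Lip A f"
      unfolding Lip_def
    proof (rule cInf_greatest[OF ne])
      fix D assume "D \<in> {C. C-lipschitz_on A f}"
      then show "dist (f x) (f y) / dist x y \<le> D"
        using xy False by (auto simp: divide_le_eq dest: lipschitz_onD)
    qed
    then show ?thesis using False by (simp add: divide_le_eq)
  qed simp
qed

theorem theorem6p3:
  fixes X Xhat :: "'a::metric_space set"
    and L :: nat
    and \<phi> :: "nat \<Rightarrow> 'a \<Rightarrow> 'a"
    and \<rho> :: "nat \<Rightarrow> real \<Rightarrow> real"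
    and uS u :: "'a \<Rightarrow> real"
    and r :: "'a \<Rightarrow> 'a"
    and \<epsilon> :: real
  assumes "complete X"
    and "ifzs X L \<phi> \<rho>"
    and "\<forall>j\<in>{1..L}. banach_contraction X (\<phi> j)"
    and "is_fuzzy_attractor X L \<phi> \<rho> uS"
    and "\<epsilon> > 0"
    and "proper_eps_net X \<epsilon> Xhat"
    and "eps_projection X \<epsilon> Xhat r"
    and "u \<in> fuzzy_star Xhat"
  defines "\<alpha>S \<equiv> contraction_factor X L \<phi>"
    and "Zhat \<equiv> ifzs_op Xhat L (discretized_maps Xhat r \<phi>) \<rho>"
  shows "(\<forall>n. d_infty X (zero_ext X Xhat ((Zhat ^^ n) u)) uS
                \<le> 5 * \<epsilon> / (1 - \<alpha>S) + \<alpha>S ^ n * d_infty X (zero_ext X Xhat u) uS)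
       \<and> (\<exists>n0. \<forall>n\<ge>n0. attractor_with_resolution X L \<phi> \<rho> (6 * \<epsilon> / (1 - \<alpha>S))
                            (zero_ext X Xhat ((Zhat ^^ n) u)))"
proof -
  let ?\<psi> = "discretized_maps Xhat r \<phi>"
  let ?e = "zero_ext X Xhat"
  have adm: "admissible_grey_maps L \<rho>"
    and \<phi>: "\<And>j. j \<in> {1..L} \<Longrightarrow> \<phi> j \<in> X \<rightarrow> X"
    and \<phi>_cont: "\<And>j. j \<in> {1..L} \<Longrightarrow> continuous_on X (\<phi> j)"
    using assms(2) by (auto simp: ifzs_def)
  have ne: "{1..L} \<noteq> {}" using adm by (auto simp: admissible_grey_maps_def)
  have sub: "Xhat \<subseteq> X" using assms(6) by (auto simp: proper_eps_net_def eps_net_def)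
  have fin: "finite D" if "D \<subseteq> Xhat" "bounded D" for D
  proof -
    have "finite (D \<inter> Xhat)" using assms(6) that sub by (auto simp: proper_eps_net_def)
    then show ?thesis using that(1) by (simp add: Int_absorb2)
  qed
  have r: "\<And>x. x \<in> X \<Longrightarrow> r x \<in> Xhat" "\<And>x. x \<in> X \<Longrightarrow> dist x (r x) \<le> \<epsilon>"
    using assms(7) by (auto simp: eps_projection_def)
  have \<psi>: "?\<psi> j \<in> Xhat \<rightarrow> Xhat" if "j \<in> {1..L}" for j
    using \<phi>[OF that] r(1) sub by (auto simp: discretized_maps_def Pi_iff subset_iff)
  have lip: "(Lip X (\<phi> j))-lipschitz_on X (\<phi> j)" "Lip X (\<phi> j) < 1" if "j \<in> {1..L}" for j
    using assms(3) that by (auto simp: banach_contraction_def intro: Lip_lipschitz)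
  have Lip_le: "Lip X (\<phi> j) \<le> \<alpha>S" if "j \<in> {1..L}" for j
    unfolding \<alpha>S_def contraction_factor_def using that by (intro Max_ge) auto
  have \<alpha>1: "\<alpha>S < 1"
    unfolding \<alpha>S_def contraction_factor_def using ne lip(2) by (subst Max_less_iff) auto
  have \<alpha>0: "0 \<le> \<alpha>S"
    using ne Lip_le lipschitz_on_nonneg[OF lip(1)] by (meson all_not_in_conv order_trans)
  have contr: "dist (\<phi> j x) (\<phi> j y) \<le> \<alpha>S * dist x y" if "j \<in> {1..L}" "x \<in> X" "y \<in> X" for j x y
    using lipschitz_onD[OF lip(1)[OF that(1)] that(2,3)] mult_right_mono[OF Lip_le[OF that(1)], of "dist x y"]
    by simp
  \<comment> \<open>The detour through \<open>\<phi> j x\<close> costs \<open>\<epsilon>\<close> for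
    the projection and \<open>\<alpha>S * c\<close> for the contraction.\<close>
  have \<psi>_dist: "dist (?\<psi> j x) (\<phi> j y) \<le> \<alpha>S * c + \<epsilon>"
    if j: "j \<in> {1..L}" and x: "x \<in> Xhat" and y: "y \<in> X" and xy: "dist x y \<le> c" for j x y c
  proof -
    have xX: "x \<in> X" using x sub by auto
    then have "\<phi> j x \<in> X" using \<phi>[OF j] by auto
    then have "dist (r (\<phi> j x)) (\<phi> j x) \<le> \<epsilon>" using r(2) by (simp add: dist_commute)
    moreover have "dist (\<phi> j x) (\<phi> j y) \<le> \<alpha>S * c"
      using contr[OF j xX y] mult_left_mono[OF xy \<alpha>0] by simp
    ultimately show ?thesis
      using dist_triangle[of "r (\<phi> j x)" "\<phi> j y" "\<phi> j x"] x by (simp add: discretized_maps_def)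
  qed
  have uS: "uS \<in> fuzzy_star X" "ifzs_op X L \<phi> \<rho> uS = uS"
    using assms(4) by (auto simp: is_fuzzy_attractor_def)
  have uSf: "uS \<in> fuzzy_sets X" using uS(1) by (auto simp: fuzzy_star_def)
  have star: "(Zhat ^^ n) u \<in> fuzzy_star Xhat" for n
  proof (induction n)
    case (Suc n)
    then show ?case
      using ifzs_op_fuzzy_star_finite_support[OF adm \<psi> _ fin] by (simp add: Zhat_def)
  qed (use assms(8) in simp)
  have star_X: "?e ((Zhat ^^ n) u) \<in> fuzzy_star X" for n
    using zero_ext_fuzzy_star[OF star fuzzy_star_finite_support[OF star fin] sub] .
  define d where "d = d_infty X (?e u) uS"
  \<comment> \<open>Closed form of the recursion
    \<open>c (Suc n) = \<alpha>S * c n + \<epsilon>\<close> with \<open>c 0 = d\<close>: a partial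
    geometric sum of the projection errors plus the contracted initial distance.\<close>
  define c where "c n = \<epsilon> * (1 - \<alpha>S ^ n) / (1 - \<alpha>S) + \<alpha>S ^ n * d" for n
  have c_Suc: "c (Suc n) = \<alpha>S * c n + \<epsilon>" for n
    using \<alpha>1 by (simp add: c_def field_simps)
  have reach: "fuzzy_reach Xhat X (c n) ((Zhat ^^ n) u) uS \<and> fuzzy_reach X Xhat (c n) uS ((Zhat ^^ n) u)" for n
  proof (induction n)
    case 0
    have "?e u \<in> fuzzy_star X" using star_X[of 0] by simp
    then have "fuzzy_reach X X d (?e u) uS" "fuzzy_reach X X d uS (?e u)"
      using fuzzy_reach_d_infty[of "?e u" X uS] fuzzy_reach_d_infty[of uS X "?e u"] uS(1)
      by (simp_all add: d_def d_infty_commute[of X "?e u"])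
    then show ?case
      by (simp add: c_def fuzzy_reach_zero_ext_left[OF sub] fuzzy_reach_zero_ext_right[OF sub])
  next
    case (Suc n)
    let ?v = "(Zhat ^^ n) u"
    have v: "?v \<in> fuzzy_sets Xhat" using star[of n] by (auto simp: fuzzy_star_def)
    have v_att: "sup_attained Xhat g ?v" for g
      by (rule sup_attained_finite_support[OF v fuzzy_star_finite_support[OF star fin]])
    \<comment> \<open>Both sides advance by one application of their operators; since
      \<open>uS\<close> is a fixed point, the comparison is again with \<open>uS\<close>.\<close>
    have "fuzzy_reach Xhat X (\<alpha>S * c n + \<epsilon>) (ifzs_op Xhat L ?\<psi> \<rho> ?v) (ifzs_op X L \<phi> \<rho> uS)"
      by (rule fuzzy_reach_ifzs_op[OF adm v uSf v_att \<phi> \<psi>_dist conjunct1[OF Suc]])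
    moreover have "fuzzy_reach X Xhat (\<alpha>S * c n + \<epsilon>) (ifzs_op X L \<phi> \<rho> uS) (ifzs_op Xhat L ?\<psi> \<rho> ?v)"
    proof (rule fuzzy_reach_ifzs_op[OF adm uSf v _ \<psi> _ conjunct2[OF Suc]])
      show "sup_attained X (\<phi> j) uS" if "j \<in> {1..L}" for j
        by (rule sup_attained_fuzzy_star[OF uS(1) \<phi>_cont[OF that]])
      show "dist (\<phi> j x) (?\<psi> j y) \<le> \<alpha>S * c n + \<epsilon>"
        if "j \<in> {1..L}" "x \<in> X" "y \<in> Xhat" "dist x y \<le> c n" for j x y
        using \<psi>_dist[OF that(1,3,2), of "c n"] that(4) by (simp add: dist_commute)
    qed
    ultimately show ?case using uS(2) by (simp add: c_Suc Zhat_def)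
  qed
  have bound: "d_infty X (?e ((Zhat ^^ n) u)) uS \<le> \<epsilon> / (1 - \<alpha>S) + \<alpha>S ^ n * d" for n
  proof -
    have "d_infty X (?e ((Zhat ^^ n) u)) uS \<le> c n"
      using reach[of n] d_infty_le[OF star_X uS(1)]
      by (simp add: fuzzy_reach_zero_ext_left[OF sub] fuzzy_reach_zero_ext_right[OF sub])
    \<comment> \<open>Bounding the partial sum by the full geometric series gives the constant 1 in
      front of \<open>\<epsilon> / (1 - \<alpha>S)\<close>, which is sharper than the claimed
      5.\<close>
    moreover have "\<epsilon> * (1 - \<alpha>S ^ n) \<le> \<epsilon>"
      using assms(5) \<alpha>0 by (simp add: mult_left_le)
    then have "c n \<le> \<epsilon> / (1 - \<alpha>S) + \<alpha>S ^ n * d"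
      unfolding c_def using \<alpha>1 by (intro add_right_mono divide_right_mono) auto
    ultimately show ?thesis by (rule order_trans)
  qed
  have pos: "0 < \<epsilon> / (1 - \<alpha>S)" using assms(5) \<alpha>1 by simp
  have mult: "5 * \<epsilon> / (1 - \<alpha>S) = 5 * (\<epsilon> / (1 - \<alpha>S))" "6 * \<epsilon> / (1 - \<alpha>S) = 6 * (\<epsilon> / (1 - \<alpha>S))"
    by simp_all
  \<comment> \<open>Once the decaying term is below \<open>\<epsilon> / (1 - \<alpha>S)\<close>, the
    total error is below twice that quantity, which is within the claimed factor 6.\<close>
  have "(\<lambda>n. \<alpha>S ^ n * d) \<longlonglongrightarrow> 0"
    using \<alpha>0 \<alpha>1 by (intro tendsto_mult_left_zero LIMSEQ_power_zero) auto
  from order_tendstoD(2)[OF this pos]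
  obtain n0 where n0: "\<And>n. n \<ge> n0 \<Longrightarrow> \<alpha>S ^ n * d < \<epsilon> / (1 - \<alpha>S)"
    by (auto simp: eventually_sequentially)
  have "attractor_with_resolution X L \<phi> \<rho> (6 * \<epsilon> / (1 - \<alpha>S)) (?e ((Zhat ^^ n) u))"
    if "n \<ge> n0" for n
  proof -
    have "d_infty X (?e ((Zhat ^^ n) u)) uS \<le> 6 * \<epsilon> / (1 - \<alpha>S)"
      using bound[of n] n0[OF that] pos unfolding mult by linarith
    then show ?thesis
      using assms(4) star_X[of n] pos unfolding attractor_with_resolution_def mult by auto
  qed
  moreover have "d_infty X (?e ((Zhat ^^ n) u)) uS \<le> 5 * \<epsilon> / (1 - \<alpha>S) + \<alpha>S ^ n * d" for n
    using bound[of n] pos unfolding mult by linarith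
  ultimately show ?thesis unfolding d_def by blast
qed

end
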